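(* Let $\mathfrak{R}:\mathbf{H}_D\times\mathbf{H}_N\to\mathbf{X}_{\rm loc}(\mathsf{P},\Omega^+)$ be the operator defined by the exterior representation formula, $\mathfrak{R}(h,\zeta):=\big(-\mathcal{SL}_\lambda(\zeta)-\mathcal{DL}_\lambda(h)\big)\big|_{\Omega^+}$. Then $$\{0\}\times\mathsf{T}^-_{\mathsf{P},N}\big(E^\lambda_D(\mathsf{P},\Omega^-)\big)\subset\ker(\mathfrak{R}).$$
   Context: Domains and spaces. $\Omega^-\subset\mathbb{R}^3$ is a bounded simply connected domain with Lipschitz boundary $\Gamma$, $\Omega^+:=\mathbb{R}^3\setminus\overline{\Omega^-}$, and $\lambda\in\mathbb{C}$ is fixed. $\mathbf{L}^2$ denotes square-integrable (possibly vector-valued) fields, $\mathscr{D}(\Omega)$ smooth fields compactly supported in $\Omega$; the dot product and all pairings are bilinear. The subscript loc denotes functions $u$ such that $u\psi$ lies in the given space for all smooth compactly supported cutoffs $\psi$ on $\mathbb{R}^3$ (so on the bounded set $\Omega^-$ it has no effect). Operator $\mathsf{P}$ and traces. $\mathsf{P}$ is a formally self-adjoint linear differential operator matrix (in the weak sense) with domain $\mathbf{X}_{\rm loc}(\mathsf{P},\Omega)\subset\mathbf{L}^2_{\rm loc}(\Omega)$, $\Omega=\Omega^\mp$, mapping into $\mathbf{L}^2_{\rm loc}(\Omega)$, with $\mathbf{X}_{\rm loc}(\mathsf{P},\Omega)\subset\mathbf{X}^D_{\rm loc}(\Omega)\cap\mathbf{X}^N_{\rm loc}(\Omega)$ for two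 larger spaces. There are non-trivial Hilbert spaces $\mathbf{H}_D,\mathbf{H}_N$ of distributions on $\Gamma$, dual to each other under a bilinear pairing $\langle\cdot,\cdot\rangle_\Gamma$ (order of arguments immaterial), and continuous surjective linear traces $\mathsf{T}^\mp_{\mathsf{P},D}:\mathbf{X}^D_{\rm loc}(\Omega^\mp)\to\mathbf{H}_D$, $\mathsf{T}^\mp_{\mathsf{P},N}:\mathbf{X}^N_{\rm loc}(\Omega^\mp)\to\mathbf{H}_N$ with continuous right inverses, satisfying $\int_{\Omega^\mp}\mathsf{P}U\cdot V-U\cdot\mathsf{P}V\,d\mathbf{x}=\pm\langle\mathsf{T}^\mp_{\mathsf{P},N}U,\mathsf{T}^\mp_{\mathsf{P},D}V\rangle_\Gamma\mp\langle\mathsf{T}^\mp_{\mathsf{P},N}V,\mathsf{T}^\mp_{\mathsf{P},D}U\rangle_\Gamma$ for $U,V\in\mathbf{X}(\mathsf{P},\Omega^\mp)$; $\mathscr{D}(\Omega^\mp)\subset\ker\mathsf{T}^\mp_{\mathsf{P},D}\cap\ker\mathsf{T}^\mp_{\mathsf{P},N}$. Jumps and averages are $[\mathsf{T}_\bullet]:=\mathsf{T}^-_{\mathsf{P},\bullet}-\mathsf{T}^+_{\mathsf{P},\bullet}$, $\{\mathsf{T}_\bullet\}:=\frac12(\mathsf{T}^+_{\mathsf{P},\bullet}+\mathsf{T}^-_{\mathsf{P},\bullet})$, $\bullet=D,N$; $[\mathsf{T}_D\phi]=[\mathsf{T}_N\phi]=0$ if $\phi$ is smooth near $\Gamma$.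 Boundary value problems. The Dirichlet (resp. Neumann) problem in $\Omega^\mp$ is $\mathsf{P}U-\lambda U=0$ in $\Omega^\mp$, $\mathsf{T}^\mp_{\mathsf{P},D}U=g$ (resp. $\mathsf{T}^\mp_{\mathsf{P},N}U=\eta$) on $\Gamma$, together with radiation conditions at infinity (a fixed linear condition) in the case of $\Omega^+$. Standing assumption: the exterior Dirichlet and Neumann problems (in $\Omega^+$) have at most one solution in $\mathbf{X}_{\rm loc}(\mathsf{P},\Omega^+)$. Potentials. There is a Green tensor $\mathbf{G}_\lambda$, smooth on $\mathbb{R}^3\setminus\{0\}$, with $(\mathsf{P}-\lambda\mathrm{Id})\mathbf{G}_\lambda=\delta_0\mathrm{Id}$ in the sense of distributions and satisfying the radiation conditions. For $\eta\in\mathbf{H}_N$, $g\in\mathbf{H}_D$ set $\mathcal{SL}_\lambda(\eta):=-\mathbf{G}_\lambda\star((\mathsf{T}^-_{\mathsf{P},D})^*\eta)$ and $\mathcal{DL}_\lambda(g):=\mathbf{G}_\lambda\star((\mathsf{T}^-_{\mathsf{P},N})^*g)$. Off $\Gamma$ these solve $\mathsf{P}U-\lambda U=0$ and satisfy the radiation conditions. They are continuous $\mathcal{SL}_\lambda:\mathbf{H}_N\to\mathbf{X}_{\rm loc}(\mathsf{P},\Omega^\mp)$, $\mathcal{DL}_\lambda:\mathbf{H}_D\to\mathbf{X}_{\rm loc}(\mathsf{P},\Omega^\mp)$ and satisfy $[\mathsf{T}_D]\mathcal{DL}_\lambda=\mathrm{Id}$, $[\mathsf{T}_N]\mathcal{DL}_\lambda=0$,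 $[\mathsf{T}_D]\mathcal{SL}_\lambda=0$, $[\mathsf{T}_N]\mathcal{SL}_\lambda=\mathrm{Id}$. The representation formula $U=\mathcal{SL}_\lambda([\mathsf{T}_NU])+\mathcal{DL}_\lambda([\mathsf{T}_DU])$ holds for every $U$ on $\mathbb{R}^3\setminus\Gamma$ with $U|_{\Omega^\mp}\in\mathbf{X}_{\rm loc}(\mathsf{P},\Omega^\mp)$, $(\mathsf{P}-\lambda\mathrm{Id})U|_{\Omega^\mp}=0$, and radiation conditions at infinity. Eigenspace. $E^\lambda_D(\mathsf{P},\Omega^-):=\{U\in\mathbf{X}(\mathsf{P},\Omega^-):\mathsf{P}U=\lambda U\text{ in }\Omega^-,\ \mathsf{T}^-_{\mathsf{P},D}U=0\}$. *)

theory Defs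
  imports "HOL-Analysis.Analysis" "HOL-Library.Function_Algebras"
begin

definition partial :: "3 \<Rightarrow> (real^3 \<Rightarrow> 'a::real_normed_vector) \<Rightarrow> real^3 \<Rightarrow> 'a" where
  "partial i f x = frechet_derivative f (at x) (axis i 1)"

definition partials :: "3 list \<Rightarrow> (real^3 \<Rightarrow> 'a::real_normed_vector) \<Rightarrow> real^3 \<Rightarrow> 'a" where
  "partials is f = foldr partial is f"

text \<open>Only meant for open \<open>S\<close>: all iterated partial derivatives exist and are (Frechet)
  differentiable, hence continuous, on \<open>S\<close>.\<close>

definition smooth_on :: "(real^3) set \<Rightarrow> (real^3 \<Rightarrow> 'a::real_normed_vector) \<Rightarrow> bool" where
  "smooth_on S f \<longleftrightarrow> (\<forall>is. partials is f differentiable_on S)"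

definition supp :: "(real^3 \<Rightarrow> 'a::real_normed_vector) \<Rightarrow> (real^3) set" where
  "supp f = closure {x. f x \<noteq> 0}"

definition test_fields :: "(real^3) set \<Rightarrow> (real^3 \<Rightarrow> 'a::real_normed_vector) set" where
  "test_fields \<Omega> = {\<phi>. smooth_on UNIV \<phi> \<and> compact (supp \<phi>) \<and> supp \<phi> \<subseteq> \<Omega>}"

text \<open>Fields in \<open>L\<^sup>2\<close>, potentials and boundary data are all functionals on \<open>\<complex>\<^sup>k\<close>-valued fields, so
  that equality almost everywhere is equality. The vector space operations are pointwise.\<close>

type_synonym 'k distr = "(real^3 \<Rightarrow> complex^'k) \<Rightarrow> complex"

definition scl :: "complex \<Rightarrow> 'k::finite distr \<Rightarrow> 'k distr" where
  "scl c U = (\<lambda>\<phi>. c * U \<phi>)"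

text \<open>Elements of \<open>\<D>'(\<Omega>)\<close>; the value outside \<open>test_fields \<Omega>\<close> is normalised to 0.\<close>

definition distributions :: "(real^3) set \<Rightarrow> 'k::finite distr set" where
  "distributions \<Omega> = {U.
     (\<forall>\<phi>. \<phi> \<notin> test_fields \<Omega> \<longrightarrow> U \<phi> = 0) \<and>
     (\<forall>\<phi>\<in>test_fields \<Omega>. \<forall>\<psi>\<in>test_fields \<Omega>. U (\<lambda>x. \<phi> x + \<psi> x) = U \<phi> + U \<psi>) \<and>
     (\<forall>c. \<forall>\<phi>\<in>test_fields \<Omega>. U (\<lambda>x. c *s \<phi> x) = c * U \<phi>) \<and>
     (\<forall>K. compact K \<and> K \<subseteq> \<Omega> \<longrightarrow> (\<exists>C. \<exists>N::nat. \<forall>\<phi>\<in>test_fields \<Omega>. supp \<phi> \<subseteq> K \<longrightarrow>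
        norm (U \<phi>) \<le> C * (\<Sum>is | length is \<le> N. SUP x. norm (partials is \<phi> x))))}"

definition restrict_to :: "(real^3) set \<Rightarrow> 'k::finite distr \<Rightarrow> 'k distr" where
  "restrict_to \<Omega> U = (\<lambda>\<phi>. if \<phi> \<in> test_fields \<Omega> then U \<phi> else 0)"

definition dot :: "complex^'k::finite \<Rightarrow> complex^'k \<Rightarrow> complex" where
  "dot v w = (\<Sum>i\<in>UNIV. v $ i * w $ i)"

definition of_field :: "(real^3) set \<Rightarrow> (real^3 \<Rightarrow> complex^'k) \<Rightarrow> 'k::finite distr" where
  "of_field \<Omega> f = (\<lambda>\<phi>. if \<phi> \<in> test_fields \<Omega>
     then set_lebesgue_integral lborel \<Omega> (\<lambda>x. dot (f x) (\<phi> x)) else 0)"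

definition square_integrable :: "(real^3) set \<Rightarrow> (real^3 \<Rightarrow> complex^'k::finite) set" where
  "square_integrable \<Omega> =
     {f \<in> borel_measurable lborel. set_integrable lborel \<Omega> (\<lambda>x. (norm (f x))^2)}"

definition L2 :: "(real^3) set \<Rightarrow> 'k::finite distr set" where
  "L2 \<Omega> = of_field \<Omega> ` square_integrable \<Omega>"

definition cutoff :: "(real^3 \<Rightarrow> real) \<Rightarrow> 'k::finite distr \<Rightarrow> 'k distr" where
  "cutoff \<psi> U = (\<lambda>\<phi>. U (\<lambda>x. \<psi> x *\<^sub>R \<phi> x))"

text \<open>The cutoff functions live on the whole space, so membership in \<open>loc \<Omega> X\<close> is a condition
  up to the boundary of \<open>\<Omega>\<close>, and is local only at infinity. The product of a
  distribution on \<open>\<Omega>\<close> with a cutoff is again normalised by \<open>restrict_to\<close>.\<close>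

definition loc :: "(real^3) set \<Rightarrow> 'k::finite distr set \<Rightarrow> 'k distr set" where
  "loc \<Omega> X = {U \<in> distributions \<Omega>. \<forall>\<psi>\<in>test_fields UNIV. restrict_to \<Omega> (cutoff \<psi> U) \<in> X}"

text \<open>Distributions on a surface \<open>\<Gamma>\<close>, which may be merely Lipschitz: continuous functionals of
  the values on \<open>\<Gamma>\<close> of smooth ambient fields.\<close>

definition surface_distributions :: "(real^3) set \<Rightarrow> 'k::finite distr set" where
  "surface_distributions \<Gamma> = {T \<in> distributions UNIV.
     \<forall>\<phi>\<in>test_fields UNIV. \<forall>\<psi>\<in>test_fields UNIV. (\<forall>x\<in>\<Gamma>. \<phi> x = \<psi> x) \<longrightarrow> T \<phi> = T \<psi>}"

definition csubspace :: "'k::finite distr set \<Rightarrow> bool" where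
  "csubspace X \<longleftrightarrow> 0 \<in> X \<and> (\<forall>U\<in>X. \<forall>V\<in>X. U + V \<in> X) \<and> (\<forall>c. \<forall>U\<in>X. scl c U \<in> X)"

definition clinear_on :: "'k::finite distr set \<Rightarrow> ('k distr \<Rightarrow> 'l::finite distr) \<Rightarrow> bool" where
  "clinear_on X F \<longleftrightarrow> (\<forall>U\<in>X. \<forall>V\<in>X. F (U + V) = F U + F V) \<and>
     (\<forall>c. \<forall>U\<in>X. F (scl c U) = scl c (F U))"

definition functional_on :: "'k::finite distr set \<Rightarrow> ('k distr \<Rightarrow> complex) \<Rightarrow> bool" where
  "functional_on X F \<longleftrightarrow> (\<forall>U\<in>X. \<forall>V\<in>X. F (U + V) = F U + F V) \<and>
     (\<forall>c. \<forall>U\<in>X. F (scl c U) = c * F U)"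

definition vector_topology_on :: "'k::finite distr set \<Rightarrow> 'k distr topology \<Rightarrow> bool" where
  "vector_topology_on X \<tau> \<longleftrightarrow> topspace \<tau> = X \<and>
     continuous_map (prod_topology \<tau> \<tau>) \<tau> (\<lambda>(U, V). U + V) \<and>
     continuous_map (prod_topology euclidean \<tau>) \<tau> (\<lambda>(c, U). scl c U)"

text \<open>\<open>Metric_space\<close> requires symmetry and nonnegativity also outside the carrier.\<close>

definition ip_dist :: "'k::finite distr set \<Rightarrow> ('k distr \<Rightarrow> 'k distr \<Rightarrow> complex) \<Rightarrow>
    'k distr \<Rightarrow> 'k distr \<Rightarrow> real" where
  "ip_dist H ip U V = (if U \<in> H \<and> V \<in> H then sqrt (Re (ip (U - V) (U - V))) else 0)"

definition hilbert_space :: "'k::finite distr set \<Rightarrow> ('k distr \<Rightarrow> 'k distr \<Rightarrow> complex) \<Rightarrow> bool" where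
  "hilbert_space H ip \<longleftrightarrow> csubspace H \<and>
     (\<forall>V\<in>H. functional_on H (\<lambda>U. ip U V)) \<and>
     (\<forall>U\<in>H. \<forall>V\<in>H. ip V U = cnj (ip U V)) \<and>
     (\<forall>U\<in>H. U \<noteq> 0 \<longrightarrow> Re (ip U U) > 0) \<and>
     Metric_space.mcomplete H (ip_dist H ip)"

definition hilbert_topology ::
    "'k::finite distr set \<Rightarrow> ('k distr \<Rightarrow> 'k distr \<Rightarrow> complex) \<Rightarrow> 'k distr topology" where
  "hilbert_topology H ip = Metric_space.mtopology H (ip_dist H ip)"

definition dual_under ::
    "'n::finite distr set \<Rightarrow> 'n distr topology \<Rightarrow> 'd::finite distr set \<Rightarrow> 'd distr topology \<Rightarrow>
     ('n distr \<Rightarrow> 'd distr \<Rightarrow> complex) \<Rightarrow> bool" where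
  "dual_under HN \<tau>N HD \<tau>D b \<longleftrightarrow>
     (\<forall>\<eta>\<in>HN. functional_on HD (b \<eta>)) \<and> (\<forall>g\<in>HD. functional_on HN (\<lambda>\<eta>. b \<eta> g)) \<and>
     continuous_map (prod_topology \<tau>N \<tau>D) euclidean (\<lambda>(\<eta>, g). b \<eta> g) \<and>
     (\<forall>F. functional_on HD F \<and> continuous_map \<tau>D euclidean F \<longrightarrow>
        (\<exists>!\<eta>. \<eta> \<in> HN \<and> (\<forall>g\<in>HD. F g = b \<eta> g))) \<and>
     (\<forall>F. functional_on HN F \<and> continuous_map \<tau>N euclidean F \<longrightarrow>
        (\<exists>!g. g \<in> HD \<and> (\<forall>\<eta>\<in>HN. F \<eta> = b \<eta> g)))"

text \<open>Near each boundary point \<open>p\<close> the set is a Lipschitz subgraph over the plane through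
  \<open>p\<close> orthogonal to some unit vector \<open>n\<close>.\<close>

definition lipschitz_boundary :: "(real^3) set \<Rightarrow> bool" where
  "lipschitz_boundary \<Omega> \<longleftrightarrow> (\<forall>p\<in>frontier \<Omega>. \<exists>n r h L \<gamma>. norm n = 1 \<and> r > 0 \<and> h > 0 \<and>
     L-lipschitz_on {t. t \<bullet> n = 0} (\<gamma> :: real^3 \<Rightarrow> real) \<and>
     (\<forall>t s. t \<bullet> n = 0 \<and> norm t < r \<and> \<bar>s\<bar> < h \<longrightarrow> (p + t + s *\<^sub>R n \<in> \<Omega> \<longleftrightarrow> s < \<gamma> t)))"

text \<open>The spaces and traces depend on the domain; they are only constrained for the two domains
  \<open>\<Omega>\<^sup>-\<close> and \<open>\<Omega>\<^sup>+\<close>. \<open>XP\<close>, \<open>XD\<close>, \<open>XN\<close> are the spaces without the subscript loc; the topologies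
  belong to their local versions. \<open>radiating\<close> is the set of functionals satisfying the radiation
  conditions. \<open>green j\<close> is the \<open>j\<close>-th column of the Green tensor, which need
  not be locally integrable.\<close>

record ('m, 'd, 'n) bvp =
  dom_minus :: "(real^3) set"
  lam :: complex
  indices :: "3 list set"
  coeffs :: "3 list \<Rightarrow> real^3 \<Rightarrow> complex^'m^'m"
  XP :: "(real^3) set \<Rightarrow> 'm distr set"
  XD :: "(real^3) set \<Rightarrow> 'm distr set"
  XN :: "(real^3) set \<Rightarrow> 'm distr set"
  topP :: "(real^3) set \<Rightarrow> 'm distr topology"
  topD :: "(real^3) set \<Rightarrow> 'm distr topology"
  topN :: "(real^3) set \<Rightarrow> 'm distr topology"
  HD :: "'d distr set"
  ipD :: "'d distr \<Rightarrow> 'd distr \<Rightarrow> complex"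
  HN :: "'n distr set"
  ipN :: "'n distr \<Rightarrow> 'n distr \<Rightarrow> complex"
  pairing :: "'n distr \<Rightarrow> 'd distr \<Rightarrow> complex"
  TD :: "(real^3) set \<Rightarrow> 'm distr \<Rightarrow> 'd distr"
  TN :: "(real^3) set \<Rightarrow> 'm distr \<Rightarrow> 'n distr"
  radiating :: "'m distr set"
  green :: "'m \<Rightarrow> 'm distr"

definition dom_plus :: "('m::finite, 'd::finite, 'n::finite) bvp \<Rightarrow> (real^3) set" where
  "dom_plus B = - closure (dom_minus B)"

definition bdry :: "('m::finite, 'd::finite, 'n::finite) bvp \<Rightarrow> (real^3) set" where
  "bdry B = frontier (dom_minus B)"

definition diff_op ::
    "('m::finite, 'd::finite, 'n::finite) bvp \<Rightarrow> (real^3 \<Rightarrow> complex^'m) \<Rightarrow> real^3 \<Rightarrow> complex^'m" where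
  "diff_op B \<phi> = (\<lambda>x. \<Sum>is\<in>indices B. coeffs B is x *v partials is \<phi> x)"

text \<open>The operator on distributions is the transpose of the operator on test fields, which by
  formal self-adjointness is the weak extension of the latter.\<close>

definition opP ::
    "('m::finite, 'd::finite, 'n::finite) bvp \<Rightarrow> (real^3) set \<Rightarrow> 'm distr \<Rightarrow> 'm distr" where
  "opP B \<Omega> U = restrict_to \<Omega> (\<lambda>\<phi>. U (diff_op B \<phi>))"

definition homogeneous ::
    "('m::finite, 'd::finite, 'n::finite) bvp \<Rightarrow> (real^3) set \<Rightarrow> 'm distr \<Rightarrow> bool" where
  "homogeneous B \<Omega> U \<longleftrightarrow> opP B \<Omega> U - scl (lam B) U = 0"

definition XP_loc :: "('m::finite, 'd::finite, 'n::finite) bvp \<Rightarrow> (real^3) set \<Rightarrow> 'm distr set" where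
  "XP_loc B \<Omega> = loc \<Omega> (XP B \<Omega>)"
definition XD_loc :: "('m::finite, 'd::finite, 'n::finite) bvp \<Rightarrow> (real^3) set \<Rightarrow> 'm distr set" where
  "XD_loc B \<Omega> = loc \<Omega> (XD B \<Omega>)"
definition XN_loc :: "('m::finite, 'd::finite, 'n::finite) bvp \<Rightarrow> (real^3) set \<Rightarrow> 'm distr set" where
  "XN_loc B \<Omega> = loc \<Omega> (XN B \<Omega>)"

definition topHD :: "('m::finite, 'd::finite, 'n::finite) bvp \<Rightarrow> 'd distr topology" where
  "topHD B = hilbert_topology (HD B) (ipD B)"
definition topHN :: "('m::finite, 'd::finite, 'n::finite) bvp \<Rightarrow> 'n distr topology" where
  "topHN B = hilbert_topology (HN B) (ipN B)"

definition jumpD :: "('m::finite, 'd::finite, 'n::finite) bvp \<Rightarrow> 'm distr \<Rightarrow> 'd distr" where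
  "jumpD B U = TD B (dom_minus B) (restrict_to (dom_minus B) U)
             - TD B (dom_plus B) (restrict_to (dom_plus B) U)"

definition jumpN :: "('m::finite, 'd::finite, 'n::finite) bvp \<Rightarrow> 'm distr \<Rightarrow> 'n distr" where
  "jumpN B U = TN B (dom_minus B) (restrict_to (dom_minus B) U)
             - TN B (dom_plus B) (restrict_to (dom_plus B) U)"

definition ext_dirichlet ::
    "('m::finite, 'd::finite, 'n::finite) bvp \<Rightarrow> 'd distr \<Rightarrow> 'm distr \<Rightarrow> bool" where
  "ext_dirichlet B g U \<longleftrightarrow> U \<in> XP_loc B (dom_plus B) \<and> homogeneous B (dom_plus B) U \<and>
     TD B (dom_plus B) U = g \<and> U \<in> radiating B"

definition ext_neumann ::
    "('m::finite, 'd::finite, 'n::finite) bvp \<Rightarrow> 'n distr \<Rightarrow> 'm distr \<Rightarrow> bool" where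
  "ext_neumann B \<eta> U \<longleftrightarrow> U \<in> XP_loc B (dom_plus B) \<and> homogeneous B (dom_plus B) U \<and>
     TN B (dom_plus B) U = \<eta> \<and> U \<in> radiating B"

text \<open>Convolution of the Green tensor with a compactly supported distribution \<open>F\<close>, viewed as a
  functional on smooth fields that need not have compact support.\<close>

definition conv_green ::
    "('m::finite, 'd::finite, 'n::finite) bvp \<Rightarrow> 'm distr \<Rightarrow> 'm distr" where
  "conv_green B F = restrict_to UNIV (\<lambda>\<phi>. F (\<lambda>y. \<chi> j. green B j (\<lambda>x. \<phi> (x + y))))"

definition TD_adj :: "('m::finite, 'd::finite, 'n::finite) bvp \<Rightarrow> 'n distr \<Rightarrow> 'm distr" where
  "TD_adj B \<eta> = (\<lambda>\<psi>. pairing B \<eta> (TD B (dom_minus B) (of_field (dom_minus B) \<psi>)))"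

definition TN_adj :: "('m::finite, 'd::finite, 'n::finite) bvp \<Rightarrow> 'd distr \<Rightarrow> 'm distr" where
  "TN_adj B g = (\<lambda>\<psi>. pairing B (TN B (dom_minus B) (of_field (dom_minus B) \<psi>)) g)"

definition SL :: "('m::finite, 'd::finite, 'n::finite) bvp \<Rightarrow> 'n distr \<Rightarrow> 'm distr" where
  "SL B \<eta> = - conv_green B (TD_adj B \<eta>)"

definition DL :: "('m::finite, 'd::finite, 'n::finite) bvp \<Rightarrow> 'd distr \<Rightarrow> 'm distr" where
  "DL B g = conv_green B (TN_adj B g)"

text \<open>\<open>U\<close> coincides with a smooth field on a neighbourhood of the boundary, off the boundary.\<close>

definition smooth_near_bdry ::
    "('m::finite, 'd::finite, 'n::finite) bvp \<Rightarrow> 'm distr \<Rightarrow> bool" where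
  "smooth_near_bdry B U \<longleftrightarrow> (\<exists>W f. open W \<and> bdry B \<subseteq> W \<and> smooth_on W f \<and>
     restrict_to (W - bdry B) U = of_field (W - bdry B) f)"

text \<open>\<open>spaces\<close> contains stability under cutoffs, so that passing to the local version loses no
  element (and changes nothing on the bounded domain). \<open>smooth_fields\<close> is what makes the adjoints
  of the traces functionals on smooth fields.\<close>

locale bvp_setting =
  fixes B :: "('m::finite, 'd::finite, 'n::finite) bvp"
  assumes domain: "open (dom_minus B)" "dom_minus B \<noteq> {}" "bounded (dom_minus B)"
      "simply_connected (dom_minus B)" "lipschitz_boundary (dom_minus B)"
    and coefficients: "finite (indices B)" "\<And>is. is \<in> indices B \<Longrightarrow> smooth_on UNIV (coeffs B is)"
    and formally_self_adjoint: "\<And>\<phi> \<psi>. \<lbrakk>\<phi> \<in> test_fields UNIV; \<psi> \<in> test_fields UNIV\<rbrakk> \<Longrightarrow>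
      (LINT x|lborel. dot (diff_op B \<phi> x) (\<psi> x)) = (LINT x|lborel. dot (\<phi> x) (diff_op B \<psi> x))"
    and spaces: "\<And>\<Omega> X. \<lbrakk>\<Omega> \<in> {dom_minus B, dom_plus B}; X \<in> {XP B \<Omega>, XD B \<Omega>, XN B \<Omega>}\<rbrakk> \<Longrightarrow>
      X \<subseteq> distributions \<Omega> \<and> csubspace X \<and> X \<subseteq> loc \<Omega> X"
    and XP_square_integrable: "\<And>\<Omega> U. \<lbrakk>\<Omega> \<in> {dom_minus B, dom_plus B}; U \<in> XP B \<Omega>\<rbrakk> \<Longrightarrow>
      U \<in> L2 \<Omega> \<and> opP B \<Omega> U \<in> L2 \<Omega>"
    and XP_loc_square_integrable: "\<And>\<Omega> U. \<lbrakk>\<Omega> \<in> {dom_minus B, dom_plus B}; U \<in> XP_loc B \<Omega>\<rbrakk> \<Longrightarrow>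
      U \<in> loc \<Omega> (L2 \<Omega>) \<and> opP B \<Omega> U \<in> loc \<Omega> (L2 \<Omega>)"
    and XP_loc_sub: "\<And>\<Omega>. \<Omega> \<in> {dom_minus B, dom_plus B} \<Longrightarrow> XP_loc B \<Omega> \<subseteq> XD_loc B \<Omega> \<inter> XN_loc B \<Omega>"
    and topologies: "\<And>\<Omega>. \<Omega> \<in> {dom_minus B, dom_plus B} \<Longrightarrow>
      vector_topology_on (XP_loc B \<Omega>) (topP B \<Omega>) \<and>
      vector_topology_on (XD_loc B \<Omega>) (topD B \<Omega>) \<and>
      vector_topology_on (XN_loc B \<Omega>) (topN B \<Omega>)"
    and trace_spaces: "HD B \<subseteq> surface_distributions (bdry B)" "hilbert_space (HD B) (ipD B)"
      "HD B \<noteq> {0}" "HN B \<subseteq> surface_distributions (bdry B)" "hilbert_space (HN B) (ipN B)"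
      "HN B \<noteq> {0}" "dual_under (HN B) (topHN B) (HD B) (topHD B) (pairing B)"
    and TD: "\<And>\<Omega>. \<Omega> \<in> {dom_minus B, dom_plus B} \<Longrightarrow>
      clinear_on (XD_loc B \<Omega>) (TD B \<Omega>) \<and> continuous_map (topD B \<Omega>) (topHD B) (TD B \<Omega>) \<and>
      TD B \<Omega> ` XD_loc B \<Omega> = HD B \<and>
      (\<exists>R. continuous_map (topHD B) (topD B \<Omega>) R \<and> (\<forall>g\<in>HD B. TD B \<Omega> (R g) = g))"
    and TN: "\<And>\<Omega>. \<Omega> \<in> {dom_minus B, dom_plus B} \<Longrightarrow>
      clinear_on (XN_loc B \<Omega>) (TN B \<Omega>) \<and> continuous_map (topN B \<Omega>) (topHN B) (TN B \<Omega>) \<and>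
      TN B \<Omega> ` XN_loc B \<Omega> = HN B \<and>
      (\<exists>R. continuous_map (topHN B) (topN B \<Omega>) R \<and> (\<forall>\<eta>\<in>HN B. TN B \<Omega> (R \<eta>) = \<eta>))"
    and green_formula: "\<And>\<Omega> \<sigma> u v pu pv.
      \<lbrakk>(\<Omega>, \<sigma>) \<in> {(dom_minus B, 1), (dom_plus B, -1)};
       u \<in> square_integrable \<Omega>; v \<in> square_integrable \<Omega>;
       pu \<in> square_integrable \<Omega>; pv \<in> square_integrable \<Omega>;
       of_field \<Omega> u \<in> XP B \<Omega>; of_field \<Omega> v \<in> XP B \<Omega>;
       opP B \<Omega> (of_field \<Omega> u) = of_field \<Omega> pu; opP B \<Omega> (of_field \<Omega> v) = of_field \<Omega> pv\<rbrakk> \<Longrightarrow>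
      set_lebesgue_integral lborel \<Omega> (\<lambda>x. dot (pu x) (v x) - dot (u x) (pv x)) =
        \<sigma> * pairing B (TN B \<Omega> (of_field \<Omega> u)) (TD B \<Omega> (of_field \<Omega> v)) -
        \<sigma> * pairing B (TN B \<Omega> (of_field \<Omega> v)) (TD B \<Omega> (of_field \<Omega> u))"
    and trace_test_fields: "\<And>\<Omega> \<phi>. \<lbrakk>\<Omega> \<in> {dom_minus B, dom_plus B}; \<phi> \<in> test_fields \<Omega>\<rbrakk> \<Longrightarrow>
      of_field \<Omega> \<phi> \<in> XD_loc B \<Omega> \<inter> XN_loc B \<Omega> \<and>
      TD B \<Omega> (of_field \<Omega> \<phi>) = 0 \<and> TN B \<Omega> (of_field \<Omega> \<phi>) = 0"
    and smooth_fields: "\<And>\<Omega> \<phi>. \<lbrakk>\<Omega> \<in> {dom_minus B, dom_plus B}; smooth_on UNIV \<phi>\<rbrakk> \<Longrightarrow>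
      of_field \<Omega> \<phi> \<in> XD_loc B \<Omega> \<inter> XN_loc B \<Omega>"
    and jumpD_smooth: "\<And>U. \<lbrakk>restrict_to (dom_minus B) U \<in> XD_loc B (dom_minus B);
      restrict_to (dom_plus B) U \<in> XD_loc B (dom_plus B); smooth_near_bdry B U\<rbrakk> \<Longrightarrow> jumpD B U = 0"
    and jumpN_smooth: "\<And>U. \<lbrakk>restrict_to (dom_minus B) U \<in> XN_loc B (dom_minus B);
      restrict_to (dom_plus B) U \<in> XN_loc B (dom_plus B); smooth_near_bdry B U\<rbrakk> \<Longrightarrow> jumpN B U = 0"
    and radiation_linear: "csubspace (radiating B)"
    and radiation_at_infinity: "\<And>U V r. \<forall>\<phi>\<in>test_fields {x. norm x > r}. U \<phi> = V \<phi> \<Longrightarrow>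
      U \<in> radiating B \<longleftrightarrow> V \<in> radiating B"
    and ext_dirichlet_unique: "\<And>g U V. \<lbrakk>ext_dirichlet B g U; ext_dirichlet B g V\<rbrakk> \<Longrightarrow> U = V"
    and ext_neumann_unique: "\<And>\<eta> U V. \<lbrakk>ext_neumann B \<eta> U; ext_neumann B \<eta> V\<rbrakk> \<Longrightarrow> U = V"
    and green_smooth: "\<And>j. green B j \<in> distributions UNIV \<and>
      (\<exists>f. smooth_on (- {0}) f \<and> restrict_to (- {0}) (green B j) = of_field (- {0}) f)"
    and green_fundamental: "\<And>j \<phi>. \<phi> \<in> test_fields UNIV \<Longrightarrow>
      opP B UNIV (green B j) \<phi> - lam B * green B j \<phi> = \<phi> 0 $ j"
    and green_radiating: "\<And>j. green B j \<in> radiating B"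
    and potentials_solve: "\<And>\<Omega> \<eta> g. \<lbrakk>\<Omega> \<in> {dom_minus B, dom_plus B}; \<eta> \<in> HN B; g \<in> HD B\<rbrakk> \<Longrightarrow>
      homogeneous B \<Omega> (restrict_to \<Omega> (SL B \<eta>)) \<and> homogeneous B \<Omega> (restrict_to \<Omega> (DL B g))"
    and potentials_radiate: "\<And>\<eta> g. \<lbrakk>\<eta> \<in> HN B; g \<in> HD B\<rbrakk> \<Longrightarrow>
      restrict_to (dom_plus B) (SL B \<eta>) \<in> radiating B \<and>
      restrict_to (dom_plus B) (DL B g) \<in> radiating B"
    and potentials_continuous: "\<And>\<Omega>. \<Omega> \<in> {dom_minus B, dom_plus B} \<Longrightarrow>
      continuous_map (topHN B) (topP B \<Omega>) (\<lambda>\<eta>. restrict_to \<Omega> (SL B \<eta>)) \<and>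
      continuous_map (topHD B) (topP B \<Omega>) (\<lambda>g. restrict_to \<Omega> (DL B g))"
    and jump_relations: "\<And>g. g \<in> HD B \<Longrightarrow> jumpD B (DL B g) = g"
      "\<And>g. g \<in> HD B \<Longrightarrow> jumpN B (DL B g) = 0"
      "\<And>\<eta>. \<eta> \<in> HN B \<Longrightarrow> jumpD B (SL B \<eta>) = 0"
      "\<And>\<eta>. \<eta> \<in> HN B \<Longrightarrow> jumpN B (SL B \<eta>) = \<eta>"
    and representation: "\<And>U. \<lbrakk>U \<in> distributions (- bdry B);
      \<forall>\<Omega>\<in>{dom_minus B, dom_plus B}. restrict_to \<Omega> U \<in> XP_loc B \<Omega> \<and> homogeneous B \<Omega> (restrict_to \<Omega> U);
      restrict_to (dom_plus B) U \<in> radiating B\<rbrakk> \<Longrightarrow>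
      U = restrict_to (- bdry B) (SL B (jumpN B U) + DL B (jumpD B U))"

definition dirichlet_eigenspace ::
    "('m::finite, 'd::finite, 'n::finite) bvp \<Rightarrow> 'm distr set" where
  "dirichlet_eigenspace B = {U \<in> XP B (dom_minus B).
     opP B (dom_minus B) U = scl (lam B) U \<and> TD B (dom_minus B) U = 0}"

definition ext_rep :: "('m::finite, 'd::finite, 'n::finite) bvp \<Rightarrow> 'd distr \<times> 'n distr \<Rightarrow> 'm distr" where
  "ext_rep B = (\<lambda>(h, \<zeta>). restrict_to (dom_plus B) (- SL B \<zeta> - DL B h))"

definition ker_ext_rep ::
    "('m::finite, 'd::finite, 'n::finite) bvp \<Rightarrow> ('d distr \<times> 'n distr) set" where
  "ker_ext_rep B = {p \<in> HD B \<times> HN B. ext_rep B p = 0}"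

end

theory Submission
  imports Defs
begin

text \<open>A Dirichlet eigenfunction \<open>U\<close> on \<open>\<Omega>\<^sup>-\<close>, extended by zero across the boundary, is a radiating
  solution of the transmission problem off \<open>\<Gamma>\<close>. Its Dirichlet jump is the trace of \<open>U\<close>, that is 0,
  and its Neumann jump is the Neumann trace \<open>\<eta>\<close> of \<open>U\<close>. The representation formula therefore writes
  the extension as \<open>SL \<eta> + DL 0\<close>, and on \<open>\<Omega>\<^sup>+\<close>, where the extension vanishes, this says that \<open>(0, \<eta>)\<close>
  is annihilated by the exterior representation operator.

  The substance is that the extension by zero is a distribution on the complement of \<open>\<Gamma>\<close>.
  A test field there vanishes near \<open>\<Gamma>\<close>, so cutting it off sharply outside \<open>\<Omega>\<^sup>-\<close> keeps it smooth and
  does not increase any partial derivative; the extension is the transpose of this sharp cutoff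
  (\<open>extend_by_zero_distribution\<close>).\<close>

section \<open>Locality of iterated partial derivatives\<close>

text \<open>Functions with the same germ at \<open>x\<close> have the same candidate derivatives there, possibly none,
  so the choice operator in \<open>frechet_derivative\<close> returns the same value for both.\<close>

lemma partial_cong_open:
  assumes "open S" "x \<in> S" and eq: "\<And>y. y \<in> S \<Longrightarrow> f y = g y"
  shows "partial i f x = partial i g x"
proof -
  have "(f has_derivative f') (at x) \<longleftrightarrow> (g has_derivative f') (at x)" for f'
    using has_derivative_transform_within_open[OF _ assms(1,2)] eq by metis
  then show ?thesis
    unfolding partial_def frechet_derivative_def by simp
qed

lemma partials_cong_open:
  assumes "open S" "x \<in> S" and "\<And>y. y \<in> S \<Longrightarrow> f y = g y"
  shows "partials is f x = partials is g x"
  using assms(2)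
proof (induction "is" arbitrary: x)
  case Nil
  then show ?case using assms(3) by (simp add: partials_def)
next
  case (Cons i "is")
  have "partial i (partials is f) x = partial i (partials is g) x"
    by (rule partial_cong_open[OF assms(1) Cons.prems Cons.IH])
  then show ?case by (simp add: partials_def)
qed

lemma partials_zero [simp]: "partials is (\<lambda>_. 0 :: 'a::real_normed_vector) = (\<lambda>_. 0)"
proof (induction "is")
  case Nil
  then show ?case by (simp add: partials_def)
next
  case (Cons i "is")
  then have "partials (i # is) (\<lambda>_. 0 :: 'a) = partial i (\<lambda>_. 0)"
    by (simp add: partials_def)
  then show ?case by (simp add: partial_def fun_eq_iff)
qed

text \<open>The form in which smoothness of a piecewise field is checked: near each point the field agrees
  with a smooth field that may depend on the point.\<close>

lemma smooth_on_UNIV_local: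
  assumes "\<And>x. \<exists>S h. open S \<and> x \<in> S \<and> smooth_on UNIV h \<and> (\<forall>y\<in>S. f y = h y)"
  shows "smooth_on UNIV f"
  unfolding smooth_on_def differentiable_on_def
proof (intro allI ballI)
  fix "is" x
  obtain S h where S: "open S" "x \<in> S" and h: "smooth_on UNIV h" and eq: "\<And>y. y \<in> S \<Longrightarrow> f y = h y"
    using assms by metis
  have "partials is h differentiable (at x)"
    using h by (auto simp: smooth_on_def differentiable_on_def)
  then obtain D where "(partials is h has_derivative D) (at x)"
    by (auto simp: differentiable_def)
  then have "(partials is f has_derivative D) (at x)"
    by (rule has_derivative_transform_within_open[OF _ S]) (metis partials_cong_open S(1) eq)
  then show "partials is f differentiable (at x)"
    by (auto simp: differentiable_def)
qed

lemma smooth_on_zero [simp]: "smooth_on S (\<lambda>_. 0)"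
  by (simp add: smooth_on_def)

lemma partials_eq_0_off_supp:
  assumes "x \<notin> supp f"
  shows "partials is f x = 0"
proof -
  have "partials is f x = partials is (\<lambda>_. 0) x"
  proof (rule partials_cong_open)
    show "open (- supp f)" by (simp add: supp_def open_Compl)
    show "f y = 0" if "y \<in> - supp f" for y
      using that closure_subset[of "{x. f x \<noteq> 0}"] by (auto simp: supp_def)
  qed (use assms in simp)
  then show ?thesis by simp
qed

text \<open>The real suprema in the continuity estimate of a distribution can be compared only when they
  are taken over bounded sets. Here compactness of the support bounds them.\<close>

lemma bdd_above_norm_partials:
  assumes "\<phi> \<in> test_fields \<Omega>"
  shows "bdd_above (range (\<lambda>x. norm (partials is \<phi> x)))"
proof -
  have "continuous_on (supp \<phi>) (partials is \<phi>)"
    using assms differentiable_imp_continuous_on continuous_on_subset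
    by (fastforce simp: test_fields_def smooth_on_def)
  then have "bounded (partials is \<phi> ` supp \<phi>)"
    using assms by (auto simp: test_fields_def intro: compact_imp_bounded compact_continuous_image)
  then obtain M where M: "M > 0" "\<And>x. x \<in> supp \<phi> \<Longrightarrow> norm (partials is \<phi> x) \<le> M"
    by (auto simp: bounded_pos)
  have "norm (partials is \<phi> x) \<le> M" for x
    using M partials_eq_0_off_supp[of x \<phi> "is"] by (cases "x \<in> supp \<phi>") auto
  then show ?thesis by (auto intro!: bdd_aboveI)
qed

section \<open>Test fields form a vector space\<close>

text \<open>Distributions take the value 0 off the test fields, so additivity and homogeneity of a
  functional defined by a case distinction on test fields depend on these closure properties.\<close>

lemma partials_add:
  assumes "smooth_on UNIV f" "smooth_on UNIV g"
  shows "partials is (\<lambda>x. f x + g x) = (\<lambda>x. partials is f x + partials is g x)"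
proof (induction "is")
  case Nil
  then show ?case by (simp add: partials_def)
next
  case (Cons i "is")
  have "partials is f differentiable (at x)" "partials is g differentiable (at x)" for x
    using assms by (auto simp: smooth_on_def differentiable_on_def)
  then have "frechet_derivative (\<lambda>x. partials is f x + partials is g x) (at x) =
      (\<lambda>h. frechet_derivative (partials is f) (at x) h + frechet_derivative (partials is g) (at x) h)" for x
    by (intro frechet_derivative_at[symmetric] has_derivative_add) (simp_all add: frechet_derivative_works)
  moreover have "partials (i # is) (\<lambda>x. f x + g x) = partial i (\<lambda>x. partials is f x + partials is g x)"
    using Cons.IH by (simp add: partials_def)
  ultimately show ?case
    by (simp add: partials_def partial_def fun_eq_iff)
qed

lemma partials_bounded_linear:
  assumes "bounded_linear L" "smooth_on UNIV f"
  shows "partials is (\<lambda>x. L (f x)) = (\<lambda>x. L (partials is f x))"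
proof (induction "is")
  case Nil
  then show ?case by (simp add: partials_def)
next
  case (Cons i "is")
  have "partials is f differentiable (at x)" for x
    using assms by (auto simp: smooth_on_def differentiable_on_def)
  then have "frechet_derivative (\<lambda>x. L (partials is f x)) (at x) =
      (\<lambda>h. L (frechet_derivative (partials is f) (at x) h))" for x
    by (intro frechet_derivative_at[symmetric] bounded_linear.has_derivative[OF assms(1)])
       (simp add: frechet_derivative_works)
  moreover have "partials (i # is) (\<lambda>x. L (f x)) = partial i (\<lambda>x. L (partials is f x))"
    using Cons.IH by (simp add: partials_def)
  ultimately show ?case
    by (simp add: partials_def partial_def fun_eq_iff)
qed

lemma compact_supp_subset:
  assumes "compact K" "\<And>x. x \<notin> K \<Longrightarrow> f x = 0"
  shows "compact (supp f)" "supp f \<subseteq> K"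
proof -
  have "{x. f x \<noteq> 0} \<subseteq> K" using assms(2) by blast
  then show sub: "supp f \<subseteq> K"
    unfolding supp_def using assms(1) by (intro closure_minimal compact_imp_closed)
  then show "compact (supp f)"
    using compact_Int_closed[OF assms(1), of "supp f"] by (simp add: supp_def Int_absorb1)
qed

lemma not_in_supp_imp_zero: "x \<notin> supp \<phi> \<Longrightarrow> \<phi> x = 0"
  using closure_subset[of "{x. \<phi> x \<noteq> 0}"] by (auto simp: supp_def)

lemma test_fields_add:
  assumes "\<phi> \<in> test_fields \<Omega>" "\<psi> \<in> test_fields \<Omega>"
  shows "(\<lambda>x. \<phi> x + \<psi> x) \<in> test_fields \<Omega>"
proof -
  have "smooth_on UNIV (\<lambda>x. \<phi> x + \<psi> x)"
    using assms by (auto simp: test_fields_def partials_add smooth_on_def[of _ "\<lambda>x. \<phi> x + \<psi> x"])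
      (auto simp: smooth_on_def intro: differentiable_on_add)
  moreover have "compact (supp \<phi> \<union> supp \<psi>)" "supp \<phi> \<union> supp \<psi> \<subseteq> \<Omega>"
    using assms by (auto simp: test_fields_def)
  moreover have "\<phi> x + \<psi> x = 0" if "x \<notin> supp \<phi> \<union> supp \<psi>" for x
    using that not_in_supp_imp_zero[of x \<phi>] not_in_supp_imp_zero[of x \<psi>] by simp
  ultimately show ?thesis
    using compact_supp_subset[of "supp \<phi> \<union> supp \<psi>" "\<lambda>x. \<phi> x + \<psi> x"] by (auto simp: test_fields_def)
qed

lemma test_fields_bounded_linear:
  assumes "bounded_linear L" "\<phi> \<in> test_fields \<Omega>"
  shows "(\<lambda>x. L (\<phi> x)) \<in> test_fields \<Omega>"
proof -
  have \<phi>: "smooth_on UNIV \<phi>" "compact (supp \<phi>)" "supp \<phi> \<subseteq> \<Omega>"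
    using assms(2) by (auto simp: test_fields_def)
  have "(\<lambda>x. L (partials is \<phi> x)) differentiable at x" for "is" x
    using \<phi>(1) bounded_linear.has_derivative[OF assms(1)]
    by (fastforce simp: smooth_on_def differentiable_on_def differentiable_def)
  then have "smooth_on UNIV (\<lambda>x. L (\<phi> x))"
    using partials_bounded_linear[OF assms(1) \<phi>(1)] by (simp add: smooth_on_def differentiable_on_def)
  moreover have "L (\<phi> x) = 0" if "x \<notin> supp \<phi>" for x
    using not_in_supp_imp_zero[OF that] linear_0[OF bounded_linear.linear[OF assms(1)]] by simp
  ultimately show ?thesis
    using compact_supp_subset[of "supp \<phi>" "\<lambda>x. L (\<phi> x)"] \<phi> by (auto simp: test_fields_def)
qed

text \<open>The scalars are complex, so this is not the scaling by reals of the underlying normed space.\<close>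

lemma bounded_linear_complex_scaling: "bounded_linear (\<lambda>v :: complex^'k::finite. c *s v)"
  by (intro linear_conv_bounded_linear[THEN iffD1] linearI)
     (simp_all add: vec_eq_iff vector_scalar_mult_def algebra_simps)

lemma test_fields_scale:
  fixes \<phi> :: "real^3 \<Rightarrow> complex^'k::finite"
  shows "\<phi> \<in> test_fields \<Omega> \<Longrightarrow> (\<lambda>x. c *s \<phi> x) \<in> test_fields \<Omega>"
  by (rule test_fields_bounded_linear[OF bounded_linear_complex_scaling])

section \<open>Sharp cutoff of test fields\<close>

definition sharp_cutoff :: "(real^3) set \<Rightarrow> (real^3 \<Rightarrow> 'a::real_normed_vector) \<Rightarrow> real^3 \<Rightarrow> 'a" where
  "sharp_cutoff \<Omega> \<phi> = (\<lambda>x. if x \<in> \<Omega> then \<phi> x else 0)"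

text \<open>Off \<open>\<Omega>\<close> a test field that avoids the frontier is cut to zero on a whole neighbourhood:
  at frontier points because it vanishes there already, elsewhere because the exterior is open.\<close>

lemma sharp_cutoff_locally_zero:
  assumes "\<phi> \<in> test_fields (- frontier \<Omega>)" "x \<notin> \<Omega>"
  obtains S where "open S" "x \<in> S" "\<And>y. y \<in> S \<Longrightarrow> sharp_cutoff \<Omega> \<phi> y = 0"
proof (rule that[of "- supp \<phi> \<union> - closure \<Omega>"])
  show "open (- supp \<phi> \<union> - closure \<Omega>)" by (simp add: supp_def open_Un open_Compl)
  show "x \<in> - supp \<phi> \<union> - closure \<Omega>"
    using assms by (auto simp: test_fields_def frontier_def dest: interior_subset[THEN subsetD])
  show "sharp_cutoff \<Omega> \<phi> y = 0" if "y \<in> - supp \<phi> \<union> - closure \<Omega>" for y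
    using that not_in_supp_imp_zero closure_subset by (fastforce simp: sharp_cutoff_def)
qed

lemma supp_sharp_cutoff: "supp (sharp_cutoff \<Omega> \<phi>) \<subseteq> supp \<phi> \<inter> closure \<Omega>"
  by (auto simp: supp_def sharp_cutoff_def intro: closure_mono[THEN subsetD, rotated])

lemma inter_closure_subset_open:
  assumes "open \<Omega>" "K \<subseteq> - frontier \<Omega>"
  shows "K \<inter> closure \<Omega> \<subseteq> \<Omega>"
  using assms by (auto simp: frontier_def interior_open)

lemma sharp_cutoff_test_field:
  assumes "open \<Omega>" "\<phi> \<in> test_fields (- frontier \<Omega>)"
  shows "sharp_cutoff \<Omega> \<phi> \<in> test_fields \<Omega>"
proof -
  have "smooth_on UNIV (sharp_cutoff \<Omega> \<phi>)"
  proof (rule smooth_on_UNIV_local)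
    fix x
    show "\<exists>S h. open S \<and> x \<in> S \<and> smooth_on UNIV h \<and> (\<forall>y\<in>S. sharp_cutoff \<Omega> \<phi> y = h y)"
    proof (cases "x \<in> \<Omega>")
      case True
      with assms show ?thesis
        by (intro exI[of _ \<Omega>] exI[of _ \<phi>]) (auto simp: sharp_cutoff_def test_fields_def)
    next
      case False
      with assms obtain S where "open S" "x \<in> S" "\<And>y. y \<in> S \<Longrightarrow> sharp_cutoff \<Omega> \<phi> y = 0"
        by (metis sharp_cutoff_locally_zero)
      then show ?thesis
        by (intro exI[of _ S] exI[of _ "\<lambda>_. 0"]) auto
    qed
  qed
  moreover have "compact (supp (sharp_cutoff \<Omega> \<phi>))"
  proof (rule compact_supp_subset(1))
    show "compact (supp \<phi>)" using assms(2) by (simp add: test_fields_def)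
  qed (simp add: sharp_cutoff_def not_in_supp_imp_zero)
  moreover have "supp (sharp_cutoff \<Omega> \<phi>) \<subseteq> \<Omega>"
    using supp_sharp_cutoff[of \<Omega> \<phi>] inter_closure_subset_open[OF assms(1), of "supp \<phi>"] assms(2)
    by (auto simp: test_fields_def)
  ultimately show ?thesis by (simp add: test_fields_def)
qed

lemma norm_partials_sharp_cutoff_le:
  assumes "open \<Omega>" "\<phi> \<in> test_fields (- frontier \<Omega>)"
  shows "norm (partials is (sharp_cutoff \<Omega> \<phi>) x) \<le> norm (partials is \<phi> x)"
proof (cases "x \<in> \<Omega>")
  case True
  then have "partials is (sharp_cutoff \<Omega> \<phi>) x = partials is \<phi> x"
    by (intro partials_cong_open[OF assms(1)]) (auto simp: sharp_cutoff_def)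
  then show ?thesis by simp
next
  case False
  with assms obtain S where S: "open S" "x \<in> S" "\<And>y. y \<in> S \<Longrightarrow> sharp_cutoff \<Omega> \<phi> y = 0"
    by (metis sharp_cutoff_locally_zero)
  have "partials is (sharp_cutoff \<Omega> \<phi>) x = partials is (\<lambda>_. 0) x"
    by (rule partials_cong_open[OF S])
  then show ?thesis by simp
qed

lemma test_fields_mono: "\<Omega> \<subseteq> \<Omega>' \<Longrightarrow> test_fields \<Omega> \<subseteq> test_fields \<Omega>'"
  by (auto simp: test_fields_def)

lemma sharp_cutoff_inside:
  assumes "\<phi> \<in> test_fields \<Omega>"
  shows "sharp_cutoff \<Omega> \<phi> = \<phi>"
  using assms not_in_supp_imp_zero by (fastforce simp: sharp_cutoff_def test_fields_def)

lemma sharp_cutoff_outside: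
  assumes "\<phi> \<in> test_fields (- closure \<Omega>)"
  shows "sharp_cutoff \<Omega> \<phi> = (\<lambda>_. 0)"
  using assms not_in_supp_imp_zero[of _ \<phi>] closure_subset[of \<Omega>]
  by (fastforce simp: sharp_cutoff_def test_fields_def)

section \<open>Extension of a distribution by zero across the frontier\<close>

definition extend_by_zero :: "(real^3) set \<Rightarrow> 'k::finite distr \<Rightarrow> 'k distr" where
  "extend_by_zero \<Omega> U = restrict_to (- frontier \<Omega>) (\<lambda>\<phi>. U (sharp_cutoff \<Omega> \<phi>))"

lemma distribution_add:
  assumes "U \<in> distributions \<Omega>" "\<phi> \<in> test_fields \<Omega>" "\<psi> \<in> test_fields \<Omega>"
  shows "U (\<lambda>x. \<phi> x + \<psi> x) = U \<phi> + U \<psi>"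
proof -
  have "\<forall>\<phi>\<in>test_fields \<Omega>. \<forall>\<psi>\<in>test_fields \<Omega>. U (\<lambda>x. \<phi> x + \<psi> x) = U \<phi> + U \<psi>"
    using assms(1) unfolding distributions_def by (elim CollectE conjE)
  then show ?thesis using assms(2,3) by simp
qed

lemma distribution_scale:
  assumes "U \<in> distributions \<Omega>" "\<phi> \<in> test_fields \<Omega>"
  shows "U (\<lambda>x. c *s \<phi> x) = c * U \<phi>"
proof -
  have "\<forall>c. \<forall>\<phi>\<in>test_fields \<Omega>. U (\<lambda>x. c *s \<phi> x) = c * U \<phi>"
    using assms(1) unfolding distributions_def by (elim CollectE conjE)
  then show ?thesis using assms(2) by simp
qed

lemma distribution_bound:
  assumes "U \<in> distributions \<Omega>" "compact K" "K \<subseteq> \<Omega>"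
  obtains C and N :: nat where "\<And>\<phi>. \<phi> \<in> test_fields \<Omega> \<Longrightarrow> supp \<phi> \<subseteq> K \<Longrightarrow>
    norm (U \<phi>) \<le> C * (\<Sum>is | length is \<le> N. SUP x. norm (partials is \<phi> x))"
proof -
  have "\<forall>K. compact K \<and> K \<subseteq> \<Omega> \<longrightarrow> (\<exists>C. \<exists>N::nat. \<forall>\<phi>\<in>test_fields \<Omega>. supp \<phi> \<subseteq> K \<longrightarrow>
      norm (U \<phi>) \<le> C * (\<Sum>is | length is \<le> N. SUP x. norm (partials is \<phi> x)))"
    using assms(1) unfolding distributions_def by (elim CollectE conjE)
  from this[THEN spec, THEN mp, OF conjI[OF assms(2,3)]] show ?thesis
    by (elim exE) (rule that, drule (1) bspec, erule (1) mp)
qed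

lemma distribution_zero:
  assumes "U \<in> distributions \<Omega>"
  shows "U (\<lambda>_. 0) = 0"
proof -
  have "(\<lambda>_. 0) \<in> test_fields \<Omega>"
    by (simp add: test_fields_def supp_def)
  from distribution_scale[OF assms this, of 0] show ?thesis by (simp add: vector_smult_lzero)
qed

text \<open>A compact set \<open>K\<close> off the frontier meets \<open>closure \<Omega>\<close> in a compact subset of \<open>\<Omega>\<close>, and the
  estimate for \<open>U\<close> on that subset is inherited because the cutoff does not enlarge derivatives.\<close>

theorem extend_by_zero_distribution:
  assumes "open \<Omega>" and U: "U \<in> distributions \<Omega>"
  shows "extend_by_zero \<Omega> U \<in> distributions (- frontier \<Omega>)"
proof -
  let ?T = "test_fields (- frontier \<Omega>)" and ?V = "extend_by_zero \<Omega> U"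
  note cut = sharp_cutoff_test_field[OF assms(1)]
  have V: "?V \<phi> = U (sharp_cutoff \<Omega> \<phi>)" if "\<phi> \<in> ?T" for \<phi>
    using that by (simp add: extend_by_zero_def restrict_to_def)
  have "?V \<phi> = 0" if "\<phi> \<notin> ?T" for \<phi>
    using that by (simp add: extend_by_zero_def restrict_to_def)
  moreover have "?V (\<lambda>x. \<phi> x + \<psi> x) = ?V \<phi> + ?V \<psi>" if "\<phi> \<in> ?T" "\<psi> \<in> ?T" for \<phi> \<psi>
  proof -
    have "sharp_cutoff \<Omega> (\<lambda>x. \<phi> x + \<psi> x) = (\<lambda>x. sharp_cutoff \<Omega> \<phi> x + sharp_cutoff \<Omega> \<psi> x)"
      by (simp add: sharp_cutoff_def fun_eq_iff)
    moreover have "U (\<lambda>x. sharp_cutoff \<Omega> \<phi> x + sharp_cutoff \<Omega> \<psi> x) =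
        U (sharp_cutoff \<Omega> \<phi>) + U (sharp_cutoff \<Omega> \<psi>)"
      using that[THEN cut] by (rule distribution_add[OF U])
    ultimately show ?thesis
      using that by (simp add: V test_fields_add)
  qed
  moreover have "?V (\<lambda>x. c *s \<phi> x) = c * ?V \<phi>" if "\<phi> \<in> ?T" for c \<phi>
  proof -
    have "sharp_cutoff \<Omega> (\<lambda>x. c *s \<phi> x) = (\<lambda>x. c *s sharp_cutoff \<Omega> \<phi> x)"
      by (simp add: sharp_cutoff_def fun_eq_iff vector_smult_rzero)
    moreover have "U (\<lambda>x. c *s sharp_cutoff \<Omega> \<phi> x) = c * U (sharp_cutoff \<Omega> \<phi>)"
      using cut[OF that] by (rule distribution_scale[OF U])
    ultimately show ?thesis
      using that by (simp add: V test_fields_scale)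
  qed
  moreover have "\<exists>C. \<exists>N::nat. \<forall>\<phi>\<in>?T. supp \<phi> \<subseteq> K \<longrightarrow>
      norm (?V \<phi>) \<le> C * (\<Sum>is | length is \<le> N. SUP x. norm (partials is \<phi> x))"
    if K: "compact K" "K \<subseteq> - frontier \<Omega>" for K
  proof -
    have "compact (K \<inter> closure \<Omega>)" "K \<inter> closure \<Omega> \<subseteq> \<Omega>"
      using K inter_closure_subset_open[OF assms(1)] by (auto intro: compact_Int_closed)
    then obtain C and N :: nat where CN: "\<And>\<psi>. \<psi> \<in> test_fields \<Omega> \<Longrightarrow> supp \<psi> \<subseteq> K \<inter> closure \<Omega> \<Longrightarrow>
        norm (U \<psi>) \<le> C * (\<Sum>is | length is \<le> N. SUP x. norm (partials is \<psi> x))"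
      by (rule distribution_bound[OF U]) blast
    have "norm (?V \<phi>) \<le> \<bar>C\<bar> * (\<Sum>is | length is \<le> N. SUP x. norm (partials is \<phi> x))"
      if \<phi>: "\<phi> \<in> ?T" "supp \<phi> \<subseteq> K" for \<phi>
    proof -
      let ?\<psi> = "sharp_cutoff \<Omega> \<phi>"
      have SUP: "(SUP x. norm (partials is ?\<psi> x)) \<le> (SUP x. norm (partials is \<phi> x))" for "is"
        by (rule cSUP_mono)
           (use bdd_above_norm_partials[OF \<phi>(1)] norm_partials_sharp_cutoff_le[OF assms(1) \<phi>(1)] in auto)
      have nonneg: "0 \<le> (SUP x. norm (partials is ?\<psi> x))" for "is"
        using cSUP_upper[OF UNIV_I bdd_above_norm_partials[OF cut[OF \<phi>(1)]], of "is" 0] norm_ge_zero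
        by (rule order_trans[rotated])
      have "norm (?V \<phi>) \<le> C * (\<Sum>is | length is \<le> N. SUP x. norm (partials is ?\<psi> x))"
        using CN[OF cut[OF \<phi>(1)]] supp_sharp_cutoff[of \<Omega> \<phi>] \<phi> by (auto simp: V)
      \<comment> \<open>\<open>distributions\<close> does not force the constant in the estimate to be nonnegative.\<close>
      also have "\<dots> \<le> \<bar>C\<bar> * (\<Sum>is | length is \<le> N. SUP x. norm (partials is ?\<psi> x))"
        by (intro mult_right_mono sum_nonneg nonneg) simp
      also have "\<dots> \<le> \<bar>C\<bar> * (\<Sum>is | length is \<le> N. SUP x. norm (partials is \<phi> x))"
        by (intro mult_left_mono sum_mono SUP) simp
      finally show ?thesis .
    qed
    then show ?thesis by blast
  qed
  ultimately show ?thesis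
    unfolding distributions_def by auto
qed

lemma extend_by_zero_inside:
  assumes "open \<Omega>" "U \<in> distributions \<Omega>"
  shows "restrict_to \<Omega> (extend_by_zero \<Omega> U) = U"
proof
  fix \<phi>
  have "test_fields \<Omega> \<subseteq> test_fields (- frontier \<Omega>)"
    using assms(1) by (intro test_fields_mono) (auto simp: frontier_def interior_open)
  then show "restrict_to \<Omega> (extend_by_zero \<Omega> U) \<phi> = U \<phi>"
    using assms(2) by (auto simp: restrict_to_def extend_by_zero_def sharp_cutoff_inside distributions_def)
qed

lemma extend_by_zero_outside:
  assumes "U \<in> distributions \<Omega>"
  shows "restrict_to (- closure \<Omega>) (extend_by_zero \<Omega> U) = 0"
  using distribution_zero[OF assms]
  by (auto simp: restrict_to_def extend_by_zero_def sharp_cutoff_outside fun_eq_iff)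

section \<open>Dirichlet eigenfunctions and the exterior representation\<close>

lemma clinear_on_zero:
  assumes "clinear_on X F" "0 \<in> X"
  shows "F 0 = 0"
proof -
  have "F (0 + 0) = F 0 + F 0"
    using assms unfolding clinear_on_def by blast
  then show ?thesis by simp
qed

theorem proposition2:
  fixes B :: "('m::finite, 'd::finite, 'n::finite) bvp"
  assumes "bvp_setting B"
  shows "{0} \<times> TN B (dom_minus B) ` dirichlet_eigenspace B \<subseteq> ker_ext_rep B"
proof -
  interpret bvp_setting B by fact
  let ?M = "dom_minus B" and ?P = "dom_plus B"
  have "(0, TN B ?M U) \<in> ker_ext_rep B" if U: "U \<in> dirichlet_eigenspace B" for U
  proof -
    define \<eta> where "\<eta> = TN B ?M U"
    define V where "V = extend_by_zero ?M U"
    have U_XP: "U \<in> XP B ?M" and U_eq: "opP B ?M U = scl (lam B) U" and U_D: "TD B ?M U = 0"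
      using U by (auto simp: dirichlet_eigenspace_def)
    have U_loc: "U \<in> XP_loc B ?M" and U_distr: "U \<in> distributions ?M"
      using spaces[of ?M "XP B ?M"] U_XP by (auto simp: XP_loc_def)
    have zero_loc: "0 \<in> XP_loc B ?P"
      using spaces[of ?P "XP B ?P"] by (auto simp: XP_loc_def csubspace_def)
    have V_minus: "restrict_to ?M V = U"
      unfolding V_def by (rule extend_by_zero_inside[OF domain(1) U_distr])
    have V_plus: "restrict_to ?P V = 0"
      unfolding V_def dom_plus_def by (rule extend_by_zero_outside[OF U_distr])
    have T0: "TD B ?P 0 = 0" "TN B ?P 0 = 0"
      using TD[of ?P] TN[of ?P] XP_loc_sub[of ?P] zero_loc clinear_on_zero by blast+
    have jumps: "jumpD B V = 0" "jumpN B V = \<eta>"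
      by (simp_all add: jumpD_def jumpN_def V_minus V_plus T0 U_D \<eta>_def)
    have "V = restrict_to (- bdry B) (SL B (jumpN B V) + DL B (jumpD B V))"
    proof (rule representation)
      show "V \<in> distributions (- bdry B)"
        unfolding V_def bdry_def by (rule extend_by_zero_distribution[OF domain(1) U_distr])
      show "restrict_to ?P V \<in> radiating B"
        using radiation_linear by (simp add: V_plus csubspace_def)
      have "homogeneous B ?M U"
        by (simp add: homogeneous_def U_eq)
      moreover have "homogeneous B ?P 0"
        by (auto simp: homogeneous_def opP_def restrict_to_def scl_def fun_eq_iff)
      ultimately show "\<forall>\<Omega>\<in>{?M, ?P}. restrict_to \<Omega> V \<in> XP_loc B \<Omega> \<and> homogeneous B \<Omega> (restrict_to \<Omega> V)"
        using U_loc zero_loc by (simp add: V_minus V_plus)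
    qed
    then have V_rep: "V = restrict_to (- bdry B) (SL B \<eta> + DL B 0)"
      unfolding jumps .
    have "ext_rep B (0, \<eta>) \<phi> = 0" for \<phi>
    proof (cases "\<phi> \<in> test_fields ?P")
      case True
      moreover have "?P \<subseteq> - bdry B"
        by (auto simp: dom_plus_def bdry_def frontier_def)
      ultimately have "V \<phi> = SL B \<eta> \<phi> + DL B 0 \<phi>"
        using test_fields_mono[of ?P "- bdry B"]
        by (subst V_rep) (auto simp: restrict_to_def)
      moreover have "V \<phi> = 0"
        using fun_cong[OF V_plus, of \<phi>] True by (simp add: restrict_to_def)
      ultimately have "- (SL B \<eta> \<phi> + DL B 0 \<phi>) = 0"
        by simp
      moreover have "ext_rep B (0, \<eta>) \<phi> = - (SL B \<eta> \<phi> + DL B 0 \<phi>)"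
        using True by (simp add: ext_rep_def restrict_to_def)
      ultimately show ?thesis
        by metis
    next
      case False
      then show ?thesis by (simp add: ext_rep_def restrict_to_def)
    qed
    then have "ext_rep B (0, \<eta>) = 0"
      by (simp add: fun_eq_iff)
    moreover have "0 \<in> HD B"
      using trace_spaces(2) by (simp add: hilbert_space_def csubspace_def)
    moreover have "\<eta> \<in> HN B"
      unfolding \<eta>_def using TN[of ?M] XP_loc_sub[of ?M] U_loc by blast
    ultimately show ?thesis
      by (simp add: ker_ext_rep_def \<eta>_def)
  qed
  then show ?thesis by blast
qed

end
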